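(* Let $\alpha\in\mathbb{R}$ with $\alpha\neq-1$ and let $T_*>0$. There exists no nontrivial solution $\theta$ of the 2D quasi-geostrophic equation on $[0,T_* )$ which, for all $t<T_*$ sufficiently close to $T_*$, is of the form $$\theta(x,t)=\frac{1}{(T_*-t)^{\frac{\alpha}{\alpha+1}}}\Theta\!\left(\frac{x}{(T_*-t)^{\frac{1}{\alpha+1}}}\right),$$ if there exist $p_1,p_2\in(0,\infty]$, $p_1<p_2$, such that $\Theta\in L^{p_1}(\mathbb{R}^2)\cap L^{p_2}(\mathbb{R}^2)$.
   Context: The 2D quasi-geostrophic equation is $$\frac{\partial\theta}{\partial t}+(v\cdot\nabla)\theta=0,\qquad v=-\nabla^{\perp}(-\Delta)^{-\frac12}\theta,\qquad \theta(x,0)=\theta_0(x),\qquad x\in\mathbb{R}^2,$$ for a scalar $\theta=\theta(x,t)$, where $\nabla^\perp=(-\partial_2,\partial_1)$. Up to a nonzero constant factor, $v$ is $\nabla^\perp\int_{\mathbb{R}^2}\frac{\theta(y,t)}{|x-y|}\,dy$; in particular $\mathrm{div}\,v=0$. Solutions are understood in the classical sense: $\theta$ is $C^1$, the equation holds pointwise, and $v\in C([0,T_* );C^1(\mathbb{R}^2;\mathbb{R}^2))$. The latter means that $v(\cdot,t)$ is $C^1$ in $x$ with bounded gradient, $v$ is continuous in $(x,t)$, and $t\mapsto\nabla v(\cdot,t)$ is continuous into the bounded continuous functions with the sup norm. "Nontrivial" means not identically zero. For $0<p<1$, $L^p(\mathbb{R}^2)$ is the set of measurable $f$ with $\int|f|^p\,dx<\infty$.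 *)

theory Defs
  imports "HOL-Analysis.Analysis"
begin

definition C1_on :: "('a::real_normed_vector) set \<Rightarrow> ('a \<Rightarrow> 'b::real_normed_vector) \<Rightarrow> bool" where
  "C1_on S f \<longleftrightarrow> (\<exists>D :: 'a \<Rightarrow> 'a \<Rightarrow>\<^sub>L 'b.
     (\<forall>z\<in>S. (f has_derivative blinfun_apply (D z)) (at z within S)) \<and> continuous_on S D)"

definition grad :: "(real^2 \<Rightarrow> real) \<Rightarrow> real^2 \<Rightarrow> real^2" where
  "grad f x = (\<chi> i. frechet_derivative f (at x) (axis i 1))"

definition perp_grad :: "(real^2 \<Rightarrow> real) \<Rightarrow> real^2 \<Rightarrow> real^2" where
  "perp_grad f x = vector [- (grad f x $ 2), grad f x $ 1]"

definition riesz_potential :: "(real^2 \<Rightarrow> real) \<Rightarrow> real^2 \<Rightarrow> real" where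
  "riesz_potential f x = 1 / (2 * pi) * (LINT y|lebesgue. f y / norm (x - y))"

text \<open>
  On the plane, the operator $(-\Delta)^{-1/2}$ is \<^const>\<open>riesz_potential\<close>. Its integral converges
  absolutely only if \<open>f\<close> decays fast enough: a function in $L^p$ with $p \ge 2$ need not have
  a potential in this sense, although its Riesz transforms, and hence the velocity, exist for all
  finite $p \ge 1$. Since the velocity depends on the potential only up to an additive constant,
  the potential is normalised to vanish at the origin. For continuous \<open>f\<close> the resulting
  integral converges absolutely as soon as $\int |f(y)| / (1 + |y|^2) \, dy$ is finite, in
  particular for \<open>f\<close> in $L^p$ with $1 \le p < \infty$. Where the plain potential exists, nothing
  changes: see \<open>qg_velocity_eq_riesz\<close> below.
\<close>

definition stream_integrand :: "(real^2 \<Rightarrow> real) \<Rightarrow> real^2 \<Rightarrow> real^2 \<Rightarrow> real" where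
  "stream_integrand f x y = f y * (1 / norm (x - y) - 1 / norm y)"

definition stream :: "(real^2 \<Rightarrow> real) \<Rightarrow> real^2 \<Rightarrow> real" where
  "stream f x = 1 / (2 * pi) * (LINT y|lebesgue. stream_integrand f x y)"

definition qg_velocity :: "(real^2 \<Rightarrow> real) \<Rightarrow> real^2 \<Rightarrow> real^2" where
  "qg_velocity f x = - perp_grad (stream f) x"

text \<open>
  Both the Bochner integral and \<^const>\<open>frechet_derivative\<close> are total; the next predicate
  excludes their default values.
\<close>

definition has_qg_velocity :: "(real^2 \<Rightarrow> real) \<Rightarrow> bool" where
  "has_qg_velocity f \<longleftrightarrow>
     (\<forall>x. integrable lebesgue (stream_integrand f x)) \<and> (\<forall>x. stream f differentiable (at x))"

lemma stream_eq_riesz: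
  assumes "\<And>x. integrable lebesgue (\<lambda>y. f y / norm (x - y))"
  shows "integrable lebesgue (stream_integrand f x)"
    and "stream f x = riesz_potential f x - riesz_potential f 0"
proof -
  have e: "stream_integrand f x = (\<lambda>y. f y / norm (x - y) - f y / norm (0 - y))"
    by (auto simp: stream_integrand_def algebra_simps)
  show "integrable lebesgue (stream_integrand f x)"
    unfolding e by (intro Bochner_Integration.integrable_diff assms)
  show "stream f x = riesz_potential f x - riesz_potential f 0"
    unfolding stream_def riesz_potential_def e
    by (subst Bochner_Integration.integral_diff[OF assms assms]) (simp add: algebra_simps)
qed

lemma qg_velocity_eq_riesz:
  assumes "\<And>x. integrable lebesgue (\<lambda>y. f y / norm (x - y))"
  shows "qg_velocity f x = - perp_grad (riesz_potential f) x"
proof -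
  have e: "stream f = (\<lambda>x. riesz_potential f x - riesz_potential f 0)"
    using stream_eq_riesz(2)[OF assms] by blast
  have "(stream f has_derivative D) (at x) \<longleftrightarrow> (riesz_potential f has_derivative D) (at x)" for D
  proof
    assume "(stream f has_derivative D) (at x)"
    from has_derivative_add[OF this has_derivative_const[of "riesz_potential f 0"]]
    show "(riesz_potential f has_derivative D) (at x)" by (simp add: e)
  next
    assume "(riesz_potential f has_derivative D) (at x)"
    from has_derivative_diff[OF this has_derivative_const[of "riesz_potential f 0"]]
    show "(stream f has_derivative D) (at x)" by (simp add: e)
  qed
  then show ?thesis
    by (simp add: qg_velocity_def perp_grad_def grad_def frechet_derivative_def)
qed

text \<open>The class $C([0,T); C^1(\mathbb{R}^2; \mathbb{R}^2))$; the field itself need not be bounded.\<close>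

definition C_C1 :: "real \<Rightarrow> (real^2 \<Rightarrow> real \<Rightarrow> real^2) \<Rightarrow> bool" where
  "C_C1 T v \<longleftrightarrow>
     continuous_on (UNIV \<times> {0..<T}) (\<lambda>(x, t). v x t) \<and>
     (\<exists>G :: real \<Rightarrow> ((real^2) \<Rightarrow>\<^sub>C ((real^2) \<Rightarrow>\<^sub>L (real^2))).
        continuous_on {0..<T} G \<and>
        (\<forall>t\<in>{0..<T}. \<forall>x.
           ((\<lambda>y. v y t) has_derivative blinfun_apply (apply_bcontfun (G t) x)) (at x)))"

text \<open>The time derivative is one-sided at time 0.\<close>

definition qg_solution ::
  "real \<Rightarrow> (real^2 \<Rightarrow> real) \<Rightarrow> (real^2 \<Rightarrow> real \<Rightarrow> real) \<Rightarrow> bool" where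
  "qg_solution T \<theta>\<^sub>0 \<theta> \<longleftrightarrow>
     C1_on (UNIV \<times> {0..<T}) (\<lambda>(x, t). \<theta> x t) \<and>
     (\<forall>t\<in>{0..<T}. has_qg_velocity (\<lambda>y. \<theta> y t)) \<and>
     C_C1 T (\<lambda>x t. qg_velocity (\<lambda>y. \<theta> y t) x) \<and>
     (\<forall>x. \<forall>t\<in>{0..<T}.
        vector_derivative (\<lambda>s. \<theta> x s) (at t within {0..<T})
          + qg_velocity (\<lambda>y. \<theta> y t) x \<bullet> grad (\<lambda>y. \<theta> y t) x = 0) \<and>
     (\<forall>x. \<theta> x 0 = \<theta>\<^sub>0 x)"

definition Lp :: "ennreal \<Rightarrow> (real^2 \<Rightarrow> real) set" where
  "Lp p = {f \<in> borel_measurable lebesgue.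
     if p = \<infinity> then \<exists>C. AE x in lebesgue. \<bar>f x\<bar> \<le> C
     else (\<integral>\<^sup>+ x. ennreal (\<bar>f x\<bar> powr enn2real p) \<partial>lebesgue) < \<infinity>}"

end

theory Submission
  imports Defs
begin

text \<open>
  The idea is that transport by a divergence-free field conserves \<open>\<integral> \<bar>\<theta>\<bar>\<^sup>p dx\<close> for every \<open>p > 0\<close>, whereas
  the self-similar form makes this integral a power of the length scale
  \<open>s = (T - t) powr (1 / (\<alpha> + 1))\<close>, namely \<open>s powr (2 - \<alpha> * p)\<close> times the integral \<open>N\<close> of the profile.
  Two distinct times with \<open>0 < N < \<infinity>\<close> force \<open>\<alpha> * p = 2\<close>. This cannot hold for two different
  exponents, so \<open>N = 0\<close> for one of them. Then the solution vanishes near \<open>T\<close> and, by conservation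
  once more, at all earlier times. An infinite exponent is first replaced by a finite one
  (\<open>Lp_finite_exponents\<close>).

  Conservation is usually read off from the volume-preserving flow of \<open>v\<close>. Here it is obtained
  without trajectories. If \<open>\<phi> \<ge> 0\<close> is a function of class \<open>C\<^sup>1\<close> and \<open>w\<close> a weight in space-time with
  compact support in space, the equation and \<open>div v = 0\<close> give
  \<open>d/dt \<integral> \<phi>(\<theta>) w dx = \<integral> \<phi>(\<theta>) (w\<^sub>t + v \<bullet> \<nabla>w) dx\<close> (\<open>weighted_integral_has_derivative\<close>).
  The velocity grows at most linearly (\<open>velocity_growth\<close>), so a bump whose support expands or
  contracts exponentially fast is monotone along the flow (\<open>moving_weight\<close>), and the right-hand
  side has a sign. Letting the bump tend to 1 compares the full integrals at two times, in
  \<open>[0, \<infinity>]\<close> and in both directions (\<open>nn_integral_le\<close>). Allowing the value \<open>\<infinity>\<close> matters,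
  because the self-similar form controls the decay of \<open>\<theta>\<close> only near \<open>T\<close>.
  The powers \<open>\<bar>\<theta>\<bar>\<^sup>p\<close> are reached by approximation (\<open>nn_integral_powr_le\<close>).

  That \<open>v\<close> is divergence free comes from the symmetry of second derivatives of the stream function,
  which has a differentiable gradient because \<open>v\<close> is differentiable.
\<close>

section \<open>Symmetry of second derivatives\<close>

text \<open>
  The mean value theorem along \<open>u\<close> turns the second difference into \<open>h\<close> times an increment of the
  first derivative in direction \<open>u\<close>, and differentiability of that derivative at the single point
  \<open>x\<close> then gives its size. The second difference is symmetric in \<open>u\<close> and \<open>w\<close>, so applying this
  twice yields symmetry of the second derivative.
\<close>

lemma second_difference_approx:
  fixes S :: "'a::real_normed_vector \<Rightarrow> real"
  assumes S: "\<And>y. (S has_derivative S' y) (at y)"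
    and u: "((\<lambda>y. S' y u) has_derivative H) (at x)"
    and "e > 0"
  shows "\<exists>d>0. \<forall>h. 0 < h \<and> h < d \<longrightarrow>
    \<bar>S (x + h *\<^sub>R u + h *\<^sub>R w) - S (x + h *\<^sub>R u) - S (x + h *\<^sub>R w) + S x - h\<^sup>2 * H w\<bar> \<le> e * h\<^sup>2"
proof -
  \<comment> \<open>All points that occur stay within \<open>h * N\<close> of \<open>x\<close>, and the two error terms add up to at most \<open>e / N * (h * N)\<close>.\<close>
  define N where "N = 2 * (norm u + norm w) + 1"
  have N: "N > 0" by (simp add: N_def add_nonneg_pos)
  have lin: "linear H"
    using u has_derivative_bounded_linear bounded_linear.linear by blast
  from u[unfolded has_derivative_at_alt] \<open>e > 0\<close> N
  obtain d where d: "d > 0"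
    "\<And>y. norm (y - x) < d \<Longrightarrow> \<bar>S' y u - S' x u - H (y - x)\<bar> \<le> e / N * norm (y - x)"
    by (metis divide_pos_pos real_norm_def)
  show ?thesis
  proof (intro exI conjI allI impI)
    show "d / N > 0" using d N by simp
    fix h :: real assume h: "0 < h \<and> h < d / N"
    define p where "p s = S (x + s *\<^sub>R u + h *\<^sub>R w) - S (x + s *\<^sub>R u)" for s
    have "(p has_derivative (\<lambda>r. r * (S' (x + s *\<^sub>R u + h *\<^sub>R w) u - S' (x + s *\<^sub>R u) u))) (at s)" for s
    proof -
      have l: "S' y (r *\<^sub>R u) = r * S' y u" for y r
        using linear_cmul[OF has_derivative_linear[OF S]] by simp
      have "((\<lambda>s. S (x + s *\<^sub>R u + k)) has_derivative (\<lambda>r. S' (x + s *\<^sub>R u + k) (r *\<^sub>R u))) (at s)" for k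
        by (rule has_derivative_compose[OF _ S]) (auto intro!: derivative_eq_intros)
      from has_derivative_diff[OF this[of "h *\<^sub>R w"] this[of 0]]
      show ?thesis by (simp add: p_def[abs_def] l right_diff_distrib)
    qed
    then have "\<exists>\<xi>\<in>{0<..<h}. p h - p 0 = (h - 0) * (S' (x + \<xi> *\<^sub>R u + h *\<^sub>R w) u - S' (x + \<xi> *\<^sub>R u) u)"
      using h by (intro mvt_simple) (auto intro: has_derivative_at_withinI)
    then obtain \<xi> where \<xi>: "0 < \<xi>" "\<xi> < h"
      "p h - p 0 = h * (S' (x + \<xi> *\<^sub>R u + h *\<^sub>R w) u - S' (x + \<xi> *\<^sub>R u) u)"
      by auto
    let ?y1 = "\<xi> *\<^sub>R u + h *\<^sub>R w" and ?y0 = "\<xi> *\<^sub>R u"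
    have n0: "norm ?y0 \<le> h * norm u" using \<xi> by (simp add: mult_right_mono)
    have n1: "norm ?y1 \<le> h * norm u + h * norm w"
      using norm_triangle_ineq[of ?y0 "h *\<^sub>R w"] n0 h by simp
    have hN: "h * N < d" using h N by (simp add: pos_less_divide_eq)
    have hN': "h * N = 2 * (h * norm u) + 2 * (h * norm w) + h" by (simp add: N_def algebra_simps)
    have hw: "0 \<le> h * norm w" "0 \<le> h * norm u" using h by simp_all
    have below_d: "a < d" if "a \<le> p + q" "0 \<le> p" "0 \<le> q" "m = 2 * p + 2 * q + r" "m < d" "0 < r"
      for a p q m r :: real
      using that by linarith
    have b1: "\<bar>S' (x + ?y1) u - S' x u - H ?y1\<bar> \<le> e / N * norm ?y1"
    proof -
      have "norm ?y1 < d" by (rule below_d[OF n1 hw(2,1) hN' hN conjunct1[OF h]])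
      then show ?thesis using d(2)[of "x + ?y1"] by simp
    qed
    have b0: "\<bar>S' (x + ?y0) u - S' x u - H ?y0\<bar> \<le> e / N * norm ?y0"
    proof -
      have "norm ?y0 < d" by (rule below_d[OF _ hw(2,1) hN' hN conjunct1[OF h]]) (use n0 hw in linarith)
      then show ?thesis using d(2)[of "x + ?y0"] by simp
    qed
    have "norm ?y1 + norm ?y0 \<le> h * N" 
      using n1 n0 hw(1) hN' conjunct1[OF h] by linarith
    then have "e / N * (norm ?y1 + norm ?y0) \<le> e / N * (h * N)"
      using \<open>e > 0\<close> N by (intro mult_left_mono) auto
    then have b2: "e / N * norm ?y1 + e / N * norm ?y0 \<le> e * h"
      using N by (simp add: distrib_left)
    have Hw: "H ?y1 - H ?y0 = h * H w"
      by (simp add: linear_add[OF lin] linear_cmul[OF lin])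
    have "\<bar>S' (x + ?y1) u - S' (x + ?y0) u - h * H w\<bar> \<le> e * h"
      using b1 b0 b2 Hw by linarith
    then have "h * \<bar>S' (x + ?y1) u - S' (x + ?y0) u - h * H w\<bar> \<le> h * (e * h)"
      using h by (intro mult_left_mono) auto
    moreover have "S (x + h *\<^sub>R u + h *\<^sub>R w) - S (x + h *\<^sub>R u) - S (x + h *\<^sub>R w) + S x - h\<^sup>2 * H w
       = h * (S' (x + ?y1) u - S' (x + ?y0) u - h * H w)"
      using \<xi>(3) by (simp add: p_def algebra_simps power2_eq_square)
    ultimately show "\<bar>S (x + h *\<^sub>R u + h *\<^sub>R w) - S (x + h *\<^sub>R u) - S (x + h *\<^sub>R w) + S x - h\<^sup>2 * H w\<bar> \<le> e * h\<^sup>2"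
      using h by (simp only: abs_mult) (simp add: power2_eq_square mult.commute mult.left_commute)
  qed
qed

lemma second_derivative_symmetric:
  fixes S :: "'a::real_normed_vector \<Rightarrow> real"
  assumes S: "\<And>y. (S has_derivative S' y) (at y)"
    and u: "((\<lambda>y. S' y u) has_derivative H) (at x)"
    and w: "((\<lambda>y. S' y w) has_derivative K) (at x)"
  shows "H w = K u"
proof -
  have "\<bar>H w - K u\<bar> \<le> e" if e: "e > 0" for e
  proof -
    obtain d where d: "d > 0" "\<And>h. 0 < h \<and> h < d \<Longrightarrow> \<bar>S (x + h *\<^sub>R u + h *\<^sub>R w)
        - S (x + h *\<^sub>R u) - S (x + h *\<^sub>R w) + S x - h\<^sup>2 * H w\<bar> \<le> e / 2 * h\<^sup>2"
      using second_difference_approx[OF S u, of "e/2" w] e by auto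
    obtain d' where d': "d' > 0" "\<And>h. 0 < h \<and> h < d' \<Longrightarrow> \<bar>S (x + h *\<^sub>R w + h *\<^sub>R u)
        - S (x + h *\<^sub>R w) - S (x + h *\<^sub>R u) + S x - h\<^sup>2 * K u\<bar> \<le> e / 2 * h\<^sup>2"
      using second_difference_approx[OF S w, of "e/2" u] e by auto
    define h where "h = min d d' / 2"
    have h: "0 < h" "h < d" "h < d'" using d d' by (auto simp: h_def)
    have "x + h *\<^sub>R w + h *\<^sub>R u = x + h *\<^sub>R u + h *\<^sub>R w" by simp
    with d(2)[of h, OF conjI[OF h(1,2)]] d'(2)[of h, OF conjI[OF h(1,3)]]
    have "\<bar>h\<^sup>2 * H w - h\<^sup>2 * K u\<bar> \<le> e / 2 * h\<^sup>2 + e / 2 * h\<^sup>2"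
      by (simp only:)
    then have "\<bar>h\<^sup>2 * H w - h\<^sup>2 * K u\<bar> \<le> e * h\<^sup>2"
      by (simp only: distrib_right[symmetric] field_sum_of_halves)
    moreover have "\<bar>h\<^sup>2 * H w - h\<^sup>2 * K u\<bar> = h\<^sup>2 * \<bar>H w - K u\<bar>"
      by (simp only: right_diff_distrib[symmetric] abs_mult abs_power2)
    ultimately have "h\<^sup>2 * \<bar>H w - K u\<bar> \<le> h\<^sup>2 * e"
      by (simp only: mult.commute)
    then show ?thesis using h by simp
  qed
  then show ?thesis
    by (metis abs_le_zero_iff dense_ge eq_iff_diff_eq_0)
qed

text \<open>
  The velocity is a rotated gradient, so its divergence is a difference of mixed second derivatives
  of the stream function. The stream function is only assumed to be differentiable; that its
  gradient is differentiable as well is exactly the differentiability of the velocity.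
\<close>

lemma qg_velocity_divergence_free:
  assumes S: "\<And>x. stream f differentiable (at x)"
    and V: "(qg_velocity f has_derivative V) (at x)"
  shows "(\<Sum>i\<in>UNIV. V (axis i 1) $ i) = 0"
proof -
  define S' where "S' y = frechet_derivative (stream f) (at y)" for y
  have S': "(stream f has_derivative S' y) (at y)" for y
    using S by (simp add: S'_def frechet_derivative_works)
  have comp: "((\<lambda>y. qg_velocity f y $ i) has_derivative (\<lambda>h. V h $ i)) (at x)" for i
    using bounded_linear.has_derivative[OF bounded_linear_vec_nth V] .
  have e1: "(\<lambda>y. qg_velocity f y $ 1) = (\<lambda>y. S' y (axis 2 1))"
    and e2: "(\<lambda>y. - qg_velocity f y $ 2) = (\<lambda>y. S' y (axis 1 1))"
    by (simp_all add: qg_velocity_def perp_grad_def grad_def S'_def)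
  have "V (axis 1 1) $ 1 = - V (axis 2 1) $ 2"
    using second_derivative_symmetric[OF S', of "axis 2 1" "\<lambda>h. V h $ 1" x "axis 1 1" "\<lambda>h. - V h $ 2"]
      comp[of 1] has_derivative_minus[OF comp[of 2]] unfolding e1 e2 by blast
  then show ?thesis by (simp add: UNIV_2)
qed

section \<open>Integrals of derivatives of compactly supported functions\<close>

lemma derivative_eq_0_outside_support:
  fixes F :: "'a::real_normed_vector \<Rightarrow> 'b::real_normed_vector"
  assumes F: "(F has_derivative F') (at x)"
    and supp: "\<And>x. norm x \<ge> R \<Longrightarrow> F x = 0"
    and x: "norm x > R"
  shows "F' h = 0"
proof -
  have "((\<lambda>x. 0) has_derivative F') (at x)"
    by (rule has_derivative_transform_within_open[OF F, of "- cball 0 R"])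
       (use x supp in \<open>auto simp: open_Compl\<close>)
  then have "F' = (\<lambda>h. 0)" by (rule has_derivative_unique[OF _ has_derivative_const])
  then show ?thesis by simp
qed

text \<open>
  The integral of a compactly supported function does not change under the translations
  \<open>x \<mapsto> x + h *\<^sub>R e\<close>; differentiating it at \<open>h = 0\<close> under the integral sign gives the claim.
\<close>

lemma has_integral_directional_derivative_0:
  fixes F :: "'a::euclidean_space \<Rightarrow> real"
  assumes F: "\<And>x. (F has_derivative F' x) (at x)"
    and cont: "continuous_on UNIV (\<lambda>x. F' x e)"
    and supp: "\<And>x. norm x \<ge> R \<Longrightarrow> F x = 0"
  shows "((\<lambda>x. F' x e) has_integral 0) UNIV"
proof -
  \<comment> \<open>The box leaves a margin of \<open>norm e\<close>, so that all translates with \<open>\<bar>h\<bar> \<le> 1\<close> are still supported in it.\<close>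
  obtain a :: 'a where a: "cball 0 (\<bar>R\<bar> + norm e) \<subseteq> cbox (-a) a"
    using bounded_subset_cbox_symmetric[OF bounded_cball] by metis
  have contF: "continuous_on A F" for A :: "'a set"
    by (rule has_derivative_continuous_on[OF has_derivative_at_withinI[OF F]])
  have out: "norm x > R" if "x \<notin> cbox (-a) a" for x
  proof -
    have "x \<notin> cball 0 (\<bar>R\<bar> + norm e)" using that a by blast
    then have "\<bar>R\<bar> + norm e < norm x" by simp
    then show ?thesis using norm_ge_zero[of e] by linarith
  qed
  have F'0: "F' x e = 0" if "x \<notin> cbox (-a) a" for x
    using derivative_eq_0_outside_support[OF F supp out[OF that]] by blast
  define K where "K h = integral (cbox (-a) a) (\<lambda>x. F (x + h *\<^sub>R e))" for h
  have Kd: "(K has_field_derivative integral (cbox (-a) a) (\<lambda>x. F' (x + 0 *\<^sub>R e) e)) (at 0 within {-1..1})"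
    unfolding K_def
  proof (rule leibniz_rule_field_derivative)
    fix h x
    have "((\<lambda>h. F (x + h *\<^sub>R e)) has_derivative (\<lambda>r. F' (x + h *\<^sub>R e) (r *\<^sub>R e))) (at h)"
      by (rule has_derivative_compose[OF _ F]) (auto intro!: derivative_eq_intros)
    moreover have "(\<lambda>r. F' (x + h *\<^sub>R e) (r *\<^sub>R e)) = (*) (F' (x + h *\<^sub>R e) e)"
      using linear_cmul[OF has_derivative_linear[OF F]] by (auto simp: mult.commute)
    ultimately show "((\<lambda>h. F (x + h *\<^sub>R e)) has_real_derivative F' (x + h *\<^sub>R e) e) (at h within {-1..1})"
      by (simp only: has_field_derivative_def has_derivative_at_withinI)
    show "(\<lambda>x. F (x + h *\<^sub>R e)) integrable_on cbox (-a) a"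
      by (intro integrable_continuous continuous_on_compose2[OF contF[of UNIV]] continuous_intros) auto
  next
    show "continuous_on ({-1..1} \<times> cbox (-a) a) (\<lambda>(h, x). F' (x + h *\<^sub>R e) e)"
      unfolding split_beta
      by (intro continuous_on_compose2[OF cont] continuous_intros) auto
  qed auto
  have Kc: "K h = integral UNIV F" if h: "h \<in> {-1..1}" for h
  proof -
    have sub: "F x = 0" if "x \<notin> cbox (-a + h *\<^sub>R e) (a + h *\<^sub>R e)" for x
    proof (rule ccontr)
      assume "F x \<noteq> 0"
      then have "norm x < R" using supp not_le by blast
      moreover have "norm (h *\<^sub>R e) \<le> norm e"
        using h mult_right_mono[of "\<bar>h\<bar>" 1 "norm e"] by auto
      ultimately have "norm (x - h *\<^sub>R e) \<le> \<bar>R\<bar> + norm e"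
        using norm_triangle_ineq4[of x "h *\<^sub>R e"] by linarith
      then have "x - h *\<^sub>R e \<in> cbox (-a) a" using a by (auto simp: subset_iff)
      then have "x \<in> cbox (-a + h *\<^sub>R e) (a + h *\<^sub>R e)"
        by (auto simp: mem_box algebra_simps)
      with that show False by blast
    qed
    have "integral UNIV F = integral (cbox (-a + h *\<^sub>R e) (a + h *\<^sub>R e)) F"
      by (rule integral_unique, rule has_integral_on_superset[OF integrable_integral[OF integrable_continuous[OF contF]]])
         (auto simp: sub)
    then show ?thesis
      using integral_shift_cbox_plus[of "-a" a F "h *\<^sub>R e"] by (simp add: K_def o_def add.commute)
  qed
  have "(K has_field_derivative 0) (at 0 within {-1..1})"
    by (rule has_field_derivative_transform_within[of "\<lambda>_. integral UNIV F" _ _ _ 1]) (auto simp: Kc)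
  with Kd have "integral (cbox (-a) a) (\<lambda>x. F' (x + 0 *\<^sub>R e) e) = 0"
    using vector_derivative_unique_within_closed_interval[of "-1" 1 0 K]
    by (simp add: has_real_derivative_iff_has_vector_derivative)
  then have "integral (cbox (-a) a) (\<lambda>x. F' x e) = 0" by simp
  then have "((\<lambda>x. F' x e) has_integral 0) (cbox (-a) a)"
    using integrable_integral[OF integrable_continuous[OF continuous_on_subset[OF cont subset_UNIV]]] by metis
  then show ?thesis by (rule has_integral_on_superset) (auto simp: F'0)
qed

text \<open>
  Since \<open>v\<close> is divergence free, \<open>f' x (v x)\<close> is the divergence of the compactly supported field
  \<open>f v\<close>, hence a sum of directional derivatives of its components.
\<close>

lemma has_integral_divergence_free_0:
  fixes f :: "real^'n \<Rightarrow> real" and v :: "real^'n \<Rightarrow> real^'n"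
  assumes f: "\<And>x. (f has_derivative f' x) (at x)"
    and f'_cont: "\<And>h. continuous_on UNIV (\<lambda>x. f' x h)"
    and v: "\<And>x. (v has_derivative v' x) (at x)"
    and v'_cont: "\<And>h. continuous_on UNIV (\<lambda>x. v' x h)"
    and div: "\<And>x. (\<Sum>i\<in>UNIV. v' x (axis i 1) $ i) = 0"
    and supp: "\<And>x. norm x \<ge> R \<Longrightarrow> f x = 0"
    and C: "cball 0 R \<subseteq> C"
  shows "((\<lambda>x. f' x (v x)) has_integral 0) C"
proof -
  have cf: "continuous_on UNIV f" and cv: "continuous_on UNIV v"
    by (rule has_derivative_continuous_on[OF has_derivative_at_withinI[OF f]],
        rule has_derivative_continuous_on[OF has_derivative_at_withinI[OF v]])
  have "((\<lambda>x. f x * v' x (axis i 1) $ i + f' x (axis i 1) * v x $ i) has_integral 0) UNIV" for i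
  proof (rule has_integral_directional_derivative_0[where F = "\<lambda>x. f x * v x $ i"
        and F' = "\<lambda>x h. f x * v' x h $ i + f' x h * v x $ i"])
    show "((\<lambda>x. f x * v x $ i) has_derivative (\<lambda>h. f x * v' x h $ i + f' x h * v x $ i)) (at x)" for x
      by (rule has_derivative_mult[OF f bounded_linear.has_derivative[OF bounded_linear_vec_nth v]])
    show "continuous_on UNIV (\<lambda>x. f x * v' x (axis i 1) $ i + f' x (axis i 1) * v x $ i)"
      by (intro continuous_intros cf cv v'_cont f'_cont)
  qed (use supp in auto)
  then have "((\<lambda>x. \<Sum>i\<in>UNIV. f x * v' x (axis i 1) $ i + f' x (axis i 1) * v x $ i)
      has_integral (\<Sum>i\<in>(UNIV::'n set). 0)) UNIV"
    by (intro has_integral_sum) auto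
  moreover have "(\<Sum>i\<in>UNIV. f x * v' x (axis i 1) $ i + f' x (axis i 1) * v x $ i) = f' x (v x)" for x
  proof -
    have l: "linear (f' x)" using f has_derivative_bounded_linear bounded_linear.linear by blast
    have "f' x (v x) = f' x (\<Sum>i\<in>UNIV. v x $ i *\<^sub>R axis i 1)"
      by (simp add: basis_expansion scalar_mult_eq_scaleR[symmetric])
    also have "\<dots> = (\<Sum>i\<in>UNIV. f' x (axis i 1) * v x $ i)"
      by (simp add: linear_sum[OF l] linear_cmul[OF l] mult.commute)
    finally show ?thesis by (simp add: sum.distrib sum_distrib_left[symmetric] div)
  qed
  ultimately have "((\<lambda>x. f' x (v x)) has_integral 0) UNIV" by simp
  moreover have "f' x (v x) = 0" if "x \<notin> C" for x
  proof -
    have "norm x > R" using that C by (auto simp: subset_iff not_le)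
    with supp show ?thesis by (rule derivative_eq_0_outside_support[OF f])
  qed
  then have "(\<lambda>x. if x \<in> C then f' x (v x) else 0) = (\<lambda>x. f' x (v x))" by auto
  ultimately show ?thesis
    using has_integral_restrict_UNIV[of C "\<lambda>x. f' x (v x)" 0] by simp
qed

section \<open>Transport by a divergence-free velocity field\<close>

text \<open>
  A classical solution of \<open>\<theta>\<^sub>t + v \<bullet> \<nabla>\<theta> = 0\<close> on \<open>[0, T)\<close>. The derivative \<open>D\<close> is taken in space and time
  together, so the equation says that \<open>D\<close> annihilates the direction \<open>(v, 1)\<close>. The spatial gradient
  \<open>G\<close> of \<open>v\<close> lives in the space of bounded continuous functions with the supremum norm: this is
  what makes \<open>v\<close> grow at most linearly, uniformly on compact time intervals.
\<close>

locale transport =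
  fixes T :: real
    and \<theta> :: "real^'n \<Rightarrow> real \<Rightarrow> real"
    and D :: "(real^'n) \<times> real \<Rightarrow> ((real^'n) \<times> real) \<Rightarrow>\<^sub>L real"
    and v :: "real^'n \<Rightarrow> real \<Rightarrow> real^'n"
    and G :: "real \<Rightarrow> (real^'n) \<Rightarrow>\<^sub>C ((real^'n) \<Rightarrow>\<^sub>L (real^'n))"
  assumes \<theta>_deriv: "\<And>z. z \<in> UNIV \<times> {0..<T} \<Longrightarrow>
      ((\<lambda>(x, t). \<theta> x t) has_derivative D z) (at z within UNIV \<times> {0..<T})"
    and D_cont: "continuous_on (UNIV \<times> {0..<T}) D"
    and v_cont: "continuous_on (UNIV \<times> {0..<T}) (\<lambda>(x, t). v x t)"
    and v_deriv: "\<And>t x. t \<in> {0..<T} \<Longrightarrow> ((\<lambda>y. v y t) has_derivative G t x) (at x)"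
    and G_cont: "continuous_on {0..<T} G"
    and div_free: "\<And>t x. t \<in> {0..<T} \<Longrightarrow> (\<Sum>i\<in>UNIV. G t x (axis i 1) $ i) = 0"
    and transported: "\<And>t x. t \<in> {0..<T} \<Longrightarrow> D (x, t) (v x t, 1) = 0"
begin

lemma \<theta>_cont: "continuous_on (UNIV \<times> {0..<T}) (\<lambda>(x, t). \<theta> x t)"
  using \<theta>_deriv by (rule has_derivative_continuous_on)

lemma \<theta>_cont_slice:
  assumes "t \<in> {0..<T}" shows "continuous_on A (\<lambda>x. \<theta> x t)"
  using continuous_on_compose2[OF \<theta>_cont, of A "\<lambda>x. (x, t)"] assms
  by (force intro: continuous_intros)

text \<open>
  A function of a transported quantity is transported. Hence conservation of integrals needs to be
  proved only for a nonnegative \<open>\<theta>\<close> itself.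
\<close>

lemma transport_compose:
  assumes \<phi>: "\<And>s. (\<phi> has_real_derivative \<phi>' s) (at s)" and \<phi>': "continuous_on UNIV \<phi>'"
  shows "transport T (\<lambda>x t. \<phi> (\<theta> x t)) (\<lambda>z. \<phi>' (\<theta> (fst z) (snd z)) *\<^sub>R D z) v G"
proof
  fix z :: "(real^'n) \<times> real" assume z: "z \<in> UNIV \<times> {0..<T}"
  have "((\<lambda>z. \<phi> ((\<lambda>(x, t). \<theta> x t) z)) has_derivative (\<lambda>h. \<phi>' ((\<lambda>(x, t). \<theta> x t) z) * D z h))
      (at z within UNIV \<times> {0..<T})"
    by (rule has_derivative_compose[OF \<theta>_deriv[OF z] \<phi>[unfolded has_field_derivative_def]])
  then show "((\<lambda>(x, t). \<phi> (\<theta> x t)) has_derivative blinfun_apply (\<phi>' (\<theta> (fst z) (snd z)) *\<^sub>R D z))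
      (at z within UNIV \<times> {0..<T})"
    by (simp add: case_prod_unfold blinfun.scaleR_left[abs_def])
next
  show "continuous_on (UNIV \<times> {0..<T}) (\<lambda>z. \<phi>' (\<theta> (fst z) (snd z)) *\<^sub>R D z)"
    using \<theta>_cont by (intro continuous_intros D_cont continuous_on_compose2[OF \<phi>']) (auto simp: case_prod_unfold)
qed (use v_cont v_deriv G_cont div_free transported in \<open>auto simp: blinfun.scaleR_left\<close>)

text \<open>
  Differentiation under the integral sign gives the integral of the time derivative
  \<open>P (0, 1)\<close> of \<open>\<theta> w\<close>. Adding \<open>P (v, 0)\<close>, which integrates to zero, turns it into the derivative
  along \<open>(v, 1)\<close>, and in that direction only the weight \<open>w\<close> varies.
\<close>

lemma weighted_integral_has_derivative:
  fixes w :: "real^'n \<Rightarrow> real \<Rightarrow> real"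
  assumes w: "\<And>z. z \<in> UNIV \<times> {0..<T} \<Longrightarrow>
      ((\<lambda>(x, t). w x t) has_derivative blinfun_apply (W z)) (at z within UNIV \<times> {0..<T})"
    and W: "continuous_on (UNIV \<times> {0..<T}) W"
    and supp: "\<And>t x. t \<in> {0..<T} \<Longrightarrow> R \<le> norm x \<Longrightarrow> w x t = 0"
    and box: "cball 0 R \<subseteq> cbox a b"
    and t: "t \<in> {0..<T}"
  shows "((\<lambda>t. integral (cbox a b) (\<lambda>x. \<theta> x t * w x t)) has_real_derivative
      integral (cbox a b) (\<lambda>x. \<theta> x t * W (x, t) (v x t, 1))) (at t within {0..<T})"
proof -
  let ?S = "UNIV \<times> {0..<T} :: ((real^'n) \<times> real) set"
  define P where "P z = \<theta> (fst z) (snd z) *\<^sub>R W z + w (fst z) (snd z) *\<^sub>R D z" for z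
  have w_cont: "continuous_on ?S (\<lambda>z. w (fst z) (snd z))"
    using has_derivative_continuous_on[OF w] by (simp add: case_prod_unfold)
  have P_cont: "continuous_on ?S P"
    unfolding P_def using \<theta>_cont w_cont by (intro continuous_intros W D_cont) (auto simp: case_prod_unfold)
  have P: "((\<lambda>z. \<theta> (fst z) (snd z) * w (fst z) (snd z)) has_derivative P z) (at z within ?S)"
    if "z \<in> ?S" for z
    using has_derivative_mult[OF \<theta>_deriv[OF that] w[OF that]]
    by (simp add: case_prod_unfold P_def blinfun.scaleR_left[abs_def] blinfun.add_left[abs_def] mult.commute)
  have P_time: "((\<lambda>t. \<theta> x t * w x t) has_real_derivative P (x, t) (0, 1)) (at t within {0..<T})"
    if "t \<in> {0..<T}" for x t
  proof -
    have "((\<lambda>t. (x, t)) has_derivative (\<lambda>h. (0, h))) (at t within {0..<T})"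
      by (auto intro!: derivative_eq_intros)
    then have "((\<lambda>s. (\<lambda>z. \<theta> (fst z) (snd z) * w (fst z) (snd z)) (x, s)) has_derivative
        (\<lambda>h. P (x, t) (0, h))) (at t within {0..<T})"
      by (rule has_derivative_in_compose2[OF P, rotated 3]) (use that in auto)
    then have "((\<lambda>t. \<theta> x t * w x t) has_derivative (\<lambda>h. P (x, t) (0, h))) (at t within {0..<T})"
      by simp
    moreover have "(\<lambda>h. P (x, t) (0, h)) = (*) (P (x, t) (0, 1))"
    proof
      show "P (x, t) (0, h) = P (x, t) (0, 1) * h" for h
        using blinfun.scaleR_right[of "P (x, t)" h "(0, 1)"] by simp
    qed
    ultimately show ?thesis by (simp only: has_field_derivative_def)
  qed
  have P_space: "((\<lambda>x. \<theta> x t * w x t) has_derivative (\<lambda>h. P (x, t) (h, 0))) (at x)" for x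
  proof -
    have "((\<lambda>x. (x, t)) has_derivative (\<lambda>h. (h, 0))) (at x within UNIV)"
      by (auto intro!: derivative_eq_intros)
    then have "((\<lambda>y. (\<lambda>z. \<theta> (fst z) (snd z) * w (fst z) (snd z)) (y, t)) has_derivative
        (\<lambda>h. P (x, t) (h, 0))) (at x within UNIV)"
      by (rule has_derivative_in_compose2[OF P, rotated 3]) (use t in auto)
    then show ?thesis by simp
  qed
  have P_slice: "continuous_on UNIV (\<lambda>x. P (x, t) h)" for h
    using continuous_on_compose2[OF P_cont, of UNIV "\<lambda>x. (x, t)"] t
    by (force intro: continuous_intros)
  have leib: "((\<lambda>t. integral (cbox a b) (\<lambda>x. \<theta> x t * w x t)) has_real_derivative
      integral (cbox a b) (\<lambda>x. P (x, t) (0, 1))) (at t within {0..<T})"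
  proof (rule leibniz_rule_field_derivative)
    show "(\<lambda>x. \<theta> x s * w x s) integrable_on cbox a b" if "s \<in> {0..<T}" for s
    proof (rule integrable_continuous)
      have "continuous_on (cbox a b) (\<lambda>x. w x s)"
        using continuous_on_compose2[OF w_cont, of "cbox a b" "\<lambda>x. (x, s)"] that
        by (force intro: continuous_intros)
      then show "continuous_on (cbox a b) (\<lambda>x. \<theta> x s * w x s)"
        by (intro continuous_intros \<theta>_cont_slice that)
    qed
    show "continuous_on ({0..<T} \<times> cbox a b) (\<lambda>(s, x). P (x, s) (0, 1))"
      unfolding case_prod_unfold
      by (intro continuous_intros continuous_on_compose2[OF P_cont]) auto
  qed (use t P_time in auto)
  have "((\<lambda>x. P (x, t) (v x t, 0)) has_integral 0) (cbox a b)"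
  proof (rule has_integral_divergence_free_0[where f = "\<lambda>x. \<theta> x t * w x t" and R = R
        and f' = "\<lambda>x h. P (x, t) (h, 0)" and v' = "\<lambda>x. blinfun_apply (G t x)"])
    show "continuous_on UNIV (\<lambda>x. blinfun_apply (apply_bcontfun (G t) x) h)" for h
      by (intro continuous_intros) auto
  qed (use t P_space P_slice v_deriv div_free supp box in auto)
  moreover have "((\<lambda>x. P (x, t) (0, 1)) has_integral integral (cbox a b) (\<lambda>x. P (x, t) (0, 1))) (cbox a b)"
    by (intro integrable_integral integrable_continuous continuous_on_subset[OF P_slice]) auto
  ultimately have "((\<lambda>x. P (x, t) (0, 1) + P (x, t) (v x t, 0)) has_integral
      integral (cbox a b) (\<lambda>x. P (x, t) (0, 1)) + 0) (cbox a b)"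
    by (intro has_integral_add)
  moreover have "P (x, t) (0, 1) + P (x, t) (v x t, 0) = \<theta> x t * W (x, t) (v x t, 1)" for x
    using transported[OF t, of x] blinfun.add_right[of "P (x, t)" "(0, 1)" "(v x t, 0)"]
    by (simp add: P_def blinfun.add_left blinfun.scaleR_left)
  ultimately have "integral (cbox a b) (\<lambda>x. \<theta> x t * W (x, t) (v x t, 1)) =
      integral (cbox a b) (\<lambda>x. P (x, t) (0, 1))"
    by (simp add: integral_unique)
  with leib show ?thesis by simp
qed

lemma velocity_growth:
  assumes ab: "0 \<le> a" "b < T"
  obtains L where "L \<ge> 0" "\<And>t x. t \<in> {a..b} \<Longrightarrow> \<bar>v x t \<bullet> x\<bar> \<le> L * (1 + x \<bullet> x)"
proof -
  have sub: "{a..b} \<subseteq> {0..<T}" using ab by auto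
  have "continuous_on {a..b} (\<lambda>t. v 0 t)"
    using continuous_on_compose2[OF v_cont, of "{a..b}" "\<lambda>t. (0, t)"] sub
    by (force intro: continuous_intros)
  then obtain M where M: "\<And>t. t \<in> {a..b} \<Longrightarrow> norm (v 0 t) \<le> M"
    using compact_continuous_image[of "{a..b}" "\<lambda>t. v 0 t"] compact_imp_bounded
    by (force simp: bounded_iff)
  obtain K where K: "\<And>t. t \<in> {a..b} \<Longrightarrow> norm (G t) \<le> K"
    using compact_continuous_image[OF continuous_on_subset[OF G_cont sub]] compact_imp_bounded
    by (force simp: bounded_iff)
  show thesis
  proof
    show "0 \<le> \<bar>M\<bar> + \<bar>K\<bar>" by simp
    fix t x assume t: "t \<in> {a..b}"
    have "norm (v x t - v 0 t) \<le> norm (G t) * norm (x - 0)"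
    proof (rule differentiable_bound[of UNIV])
      show "((\<lambda>x. v x t) has_derivative G t y) (at y within UNIV)" for y
        using v_deriv t sub by auto
      show "onorm (blinfun_apply (apply_bcontfun (G t) y)) \<le> norm (G t)" for y
        using norm_bounded[of "G t" y] by (simp add: norm_blinfun.rep_eq)
    qed auto
    also have "\<dots> \<le> K * norm x" using K[OF t] by (simp add: mult_right_mono)
    finally have "norm (v x t - v 0 t) \<le> K * norm x" .
    then have "norm (v x t) \<le> \<bar>M\<bar> + \<bar>K\<bar> * norm x"
      using M[OF t] norm_triangle_ineq2[of "v x t" "v 0 t"] mult_right_mono[of K "\<bar>K\<bar>" "norm x"]
        abs_ge_self[of M] abs_ge_self[of K] norm_ge_zero[of x] by linarith
    then have "norm (v x t) * norm x \<le> (\<bar>M\<bar> + \<bar>K\<bar> * norm x) * norm x"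
      by (simp add: mult_right_mono)
    also have "\<dots> \<le> (\<bar>M\<bar> + \<bar>K\<bar>) * (1 + x \<bullet> x)"
    proof -
      have "norm x \<le> 1 + (norm x)\<^sup>2"
        using add_mono[OF zero_le_power2[of "norm x - 1"] norm_ge_zero[of x]] by (simp add: power2_diff)
      then have "\<bar>M\<bar> * norm x \<le> \<bar>M\<bar> * (1 + (norm x)\<^sup>2)" by (simp add: mult_left_mono)
      then show ?thesis by (simp add: algebra_simps power2_norm_eq_inner[symmetric] power2_eq_square[of "norm x"])
    qed
    finally show "\<bar>v x t \<bullet> x\<bar> \<le> (\<bar>M\<bar> + \<bar>K\<bar>) * (1 + x \<bullet> x)"
      using Cauchy_Schwarz_ineq2[of "v x t" x] by simp
  qed
qed

end

section \<open>A weight that moves faster than the flow\<close>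

text \<open>
  The squared positive part makes the cutoff continuously differentiable while the derivative
  keeps one sign.
\<close>

definition cutoff :: "real \<Rightarrow> real" where
  "cutoff q = (max 0 (1 - q))\<^sup>2"

lemma cutoff_has_derivative: "(cutoff has_real_derivative - 2 * max 0 (1 - q)) (at q)"
proof -
  have sq: "((\<lambda>s. (max 0 s)\<^sup>2) has_real_derivative 2 * max 0 s) (at s)" for s :: real
  proof -
    consider "s > 0" | "s < 0" | "s = 0" by linarith
    then show ?thesis
    proof cases
      case 1
      have "((\<lambda>s. s\<^sup>2) has_real_derivative 2 * max 0 s) (at s)"
        using 1 by (auto intro!: derivative_eq_intros)
      then show ?thesis
        by (rule has_field_derivative_transform_within_open[of _ _ _ "{0<..}"]) (use 1 in auto)
    next
      case 2
      have "((\<lambda>s. 0) has_real_derivative 2 * max 0 s) (at s)"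
        using 2 by (auto intro!: derivative_eq_intros)
      then show ?thesis
        by (rule has_field_derivative_transform_within_open[of _ _ _ "{..<0}"]) (use 2 in auto)
    next
      case 3
      have "((\<lambda>h. (max 0 h)\<^sup>2 / h) \<longlongrightarrow> 0) (at (0::real))"
      proof (rule Lim_null_comparison)
        show "\<forall>\<^sub>F h in at 0. norm ((max 0 h)\<^sup>2 / h) \<le> \<bar>h\<bar>" for h :: real
          by (auto simp: max_def power2_eq_square)
        show "((\<lambda>h. \<bar>h\<bar>) \<longlongrightarrow> 0) (at (0::real))"
          by (rule tendsto_eq_intros refl | simp)+
      qed
      then show ?thesis using 3 by (simp add: DERIV_def)
    qed
  qed
  have "((\<lambda>q. (max 0 (1 - q))\<^sup>2) has_real_derivative 2 * max 0 (1 - q) * (- 1)) (at q)"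
    by (rule DERIV_chain2[OF sq]) (auto intro!: derivative_eq_intros)
  then show ?thesis by (simp add: cutoff_def[abs_def])
qed

text \<open>
  The support is a ball that shrinks (\<open>\<mu> > 0\<close>) or grows (\<open>\<mu> < 0\<close>) exponentially in time. Where
  \<open>\<bar>v \<bullet> x\<bar> \<le> L * (1 + x \<bullet> x)\<close> and \<open>\<bar>\<mu>\<bar> \<ge> 2 * L\<close>, the change of \<open>exp (\<mu> * t) * (1 + x \<bullet> x)\<close> along
  the flow has the sign of \<open>\<mu>\<close>, so the weight is monotone along trajectories. For \<open>\<epsilon> \<longrightarrow> 0\<close> it
  tends to 1.
\<close>

definition moving_weight :: "real \<Rightarrow> real \<Rightarrow> 'a::real_inner \<Rightarrow> real \<Rightarrow> real" where
  "moving_weight \<mu> \<epsilon> x t = cutoff (\<epsilon> * exp (\<mu> * t) * (1 + x \<bullet> x))"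

definition moving_weight_deriv :: "real \<Rightarrow> real \<Rightarrow> 'a::real_inner \<times> real \<Rightarrow> ('a \<times> real) \<Rightarrow>\<^sub>L real" where
  "moving_weight_deriv \<mu> \<epsilon> z =
     (- 2 * max 0 (1 - \<epsilon> * exp (\<mu> * snd z) * (1 + fst z \<bullet> fst z)) * (\<epsilon> * exp (\<mu> * snd z))) *\<^sub>R
       ((\<mu> * (1 + fst z \<bullet> fst z)) *\<^sub>R snd_blinfun + 2 *\<^sub>R (blinfun_inner_left (fst z) o\<^sub>L fst_blinfun))"

lemma moving_weight_deriv_apply:
  "moving_weight_deriv \<mu> \<epsilon> (x, t) (u, 1) =
     - 2 * max 0 (1 - \<epsilon> * exp (\<mu> * t) * (1 + x \<bullet> x)) * (\<epsilon> * exp (\<mu> * t)) * (\<mu> * (1 + x \<bullet> x) + 2 * (u \<bullet> x))"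
  unfolding moving_weight_deriv_def blinfun.scaleR_left blinfun.add_left
  by (simp add: blinfun.scaleR_left)

lemma moving_weight_has_derivative:
  "((\<lambda>(x, t). moving_weight \<mu> \<epsilon> x t) has_derivative blinfun_apply (moving_weight_deriv \<mu> \<epsilon> z)) (at z within S)"
proof -
  let ?q = "\<lambda>z. \<epsilon> * exp (\<mu> * snd z) * (1 + fst z \<bullet> fst z)"
  have q: "(?q has_derivative (\<lambda>h. \<epsilon> * exp (\<mu> * snd z) * (\<mu> * snd h) * (1 + fst z \<bullet> fst z)
      + \<epsilon> * exp (\<mu> * snd z) * (2 * (fst h \<bullet> fst z)))) (at z within S)"
    by (auto intro!: derivative_eq_intros simp: inner_commute algebra_simps)
  have "blinfun_apply (moving_weight_deriv \<mu> \<epsilon> z) =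
      (\<lambda>h. - 2 * max 0 (1 - ?q z) * (\<epsilon> * exp (\<mu> * snd z) * (\<mu> * snd h) * (1 + fst z \<bullet> fst z)
        + \<epsilon> * exp (\<mu> * snd z) * (2 * (fst h \<bullet> fst z))))"
    unfolding moving_weight_deriv_def blinfun.scaleR_left blinfun.add_left
    by (simp add: blinfun.scaleR_left fun_eq_iff algebra_simps)
  with has_derivative_compose[OF q cutoff_has_derivative[unfolded has_field_derivative_def]]
  show ?thesis
    by (simp add: moving_weight_def case_prod_unfold)
qed

lemma continuous_on_moving_weight_deriv: "continuous_on S (moving_weight_deriv \<mu> \<epsilon>)"
  unfolding moving_weight_deriv_def by (intro continuous_intros)

lemma moving_weight_nonneg: "0 \<le> moving_weight \<mu> \<epsilon> x t"
  by (simp add: moving_weight_def cutoff_def)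

lemma moving_weight_le_1: "0 < \<epsilon> \<Longrightarrow> moving_weight \<mu> \<epsilon> x t \<le> 1"
  by (auto simp: moving_weight_def cutoff_def power_le_one_iff)

lemma moving_weight_eq_0:
  assumes "0 < \<epsilon>" "t \<in> {0..<T}" "sqrt (exp (\<bar>\<mu>\<bar> * T) / \<epsilon>) \<le> norm x"
  shows "moving_weight \<mu> \<epsilon> x t = 0"
proof -
  have "exp (\<bar>\<mu>\<bar> * T) / \<epsilon> \<le> x \<bullet> x"
    using assms real_sqrt_le_iff[of "exp (\<bar>\<mu>\<bar> * T) / \<epsilon>" "x \<bullet> x"] by (simp add: norm_eq_sqrt_inner)
  then have "exp (\<bar>\<mu>\<bar> * T) \<le> \<epsilon> * (1 + x \<bullet> x)"
    using assms(1) by (simp add: field_simps)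
  moreover have "\<bar>\<mu> * t\<bar> \<le> \<bar>\<mu>\<bar> * T"
    using assms(2) by (simp add: abs_mult mult_left_mono)
  then have "exp (- (\<bar>\<mu>\<bar> * T)) \<le> exp (\<mu> * t)" by simp
  ultimately have "exp (- (\<bar>\<mu>\<bar> * T)) * exp (\<bar>\<mu>\<bar> * T) \<le> exp (\<mu> * t) * (\<epsilon> * (1 + x \<bullet> x))"
    by (intro mult_mono) auto
  then have "1 \<le> \<epsilon> * exp (\<mu> * t) * (1 + x \<bullet> x)"
    by (simp add: exp_add[symmetric] mult_ac)
  then show ?thesis by (simp add: moving_weight_def cutoff_def max_def)
qed

lemma moving_weight_tendsto_1: "(\<lambda>n. moving_weight \<mu> (inverse (real (Suc n))) x t) \<longlonglongrightarrow> 1"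
proof -
  have "(\<lambda>n. (max 0 (1 - inverse (real (Suc n)) * exp (\<mu> * t) * (1 + x \<bullet> x)))\<^sup>2)
      \<longlonglongrightarrow> (max 0 (1 - 0 * exp (\<mu> * t) * (1 + x \<bullet> x)))\<^sup>2"
    by (intro tendsto_intros LIMSEQ_inverse_real_of_nat)
  then show ?thesis by (simp add: moving_weight_def cutoff_def)
qed

section \<open>Conservation of integrals\<close>

text \<open>
  Fatou's lemma in the form in which it is used twice below: to remove the weight, and to
  pass from smooth functions of \<open>\<theta>\<close> to powers of \<open>\<bar>\<theta>\<bar>\<close>.
\<close>

lemma nn_integral_le_of_pointwise_limit:
  fixes g :: "'a \<Rightarrow> ennreal"
  assumes f: "\<And>n. f n \<in> borel_measurable M"
    and lim: "\<And>x. (\<lambda>n. f n x) \<longlonglongrightarrow> g x"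
    and bound: "\<And>n. (\<integral>\<^sup>+ x. f n x \<partial>M) \<le> C"
  shows "(\<integral>\<^sup>+ x. g x \<partial>M) \<le> C"
proof -
  have "(\<integral>\<^sup>+ x. g x \<partial>M) = (\<integral>\<^sup>+ x. liminf (\<lambda>n. f n x) \<partial>M)"
    using lim_imp_Liminf[OF _ lim] by simp
  also have "\<dots> \<le> liminf (\<lambda>n. \<integral>\<^sup>+ x. f n x \<partial>M)"
    by (rule nn_integral_liminf[OF f])
  also have "\<dots> \<le> liminf (\<lambda>n. C)"
    by (rule Liminf_mono) (simp add: bound)
  finally show ?thesis by (simp add: Liminf_const)
qed

context transport
begin

lemma \<theta>_borel: "t \<in> {0..<T} \<Longrightarrow> (\<lambda>x. \<theta> x t) \<in> borel_measurable borel"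
  by (intro borel_measurable_continuous_onI \<theta>_cont_slice)

text \<open>
  The two times may come in either order, so the integral of \<open>\<theta>\<close> is in fact conserved, as an element
  of \<open>[0, \<infinity>]\<close>. The weight is chosen to increase along trajectories from \<open>s\<close> to \<open>t\<close>; the weighted
  integral at \<open>s\<close> is then at most the one at \<open>t\<close>, hence at most the full integral at \<open>t\<close>, and the
  weight at \<open>s\<close> can be sent to 1.
\<close>

lemma nn_integral_le:
  assumes nonneg: "\<And>x t. 0 \<le> \<theta> x t" and s: "s \<in> {0..<T}" and t: "t \<in> {0..<T}"
  shows "(\<integral>\<^sup>+ x. ennreal (\<theta> x s) \<partial>lborel) \<le> (\<integral>\<^sup>+ x. ennreal (\<theta> x t) \<partial>lborel)"
proof (cases "s = t")
  case False
  obtain L where L: "L \<ge> 0" "\<And>r x. r \<in> {min s t..max s t} \<Longrightarrow> \<bar>v x r \<bullet> x\<bar> \<le> L * (1 + x \<bullet> x)"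
    using velocity_growth[of "min s t" "max s t"] s t by auto
  \<comment> \<open>With this sign the weight increases along the flow as time runs from \<open>s\<close> towards \<open>t\<close>.\<close>
  define \<mu> where "\<mu> = (if s < t then - 2 * L else 2 * L)"
  have sub: "{min s t..max s t} \<subseteq> {0..<T}" using s t by auto
  have w_cont: "continuous_on UNIV (\<lambda>x::real^'n. moving_weight \<mu> \<epsilon> x r)" for \<epsilon> r
  proof -
    have "continuous_on UNIV (\<lambda>(x, t). moving_weight \<mu> \<epsilon> (x::real^'n) t)"
      using moving_weight_has_derivative by (rule has_derivative_continuous_on)
    from continuous_on_compose2[OF this, of UNIV "\<lambda>x. (x, r)"]
    show ?thesis by (simp add: continuous_on_Pair)
  qed
  have weighted: "(\<integral>\<^sup>+ x. ennreal (\<theta> x s * moving_weight \<mu> \<epsilon> x s) \<partial>lborel) \<le> (\<integral>\<^sup>+ x. ennreal (\<theta> x t) \<partial>lborel)"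
    if \<epsilon>: "\<epsilon> > 0" for \<epsilon>
  proof -
    \<comment> \<open>Outside this radius the weight vanishes at all times in \<open>[0, T)\<close>.\<close>
    define R where "R = sqrt (exp (\<bar>\<mu>\<bar> * T) / \<epsilon>)"
    obtain b :: "real^'n" where b: "cball 0 R \<subseteq> cbox (-b) b"
      using bounded_subset_cbox_symmetric[OF bounded_cball] by metis
    have supp: "moving_weight \<mu> \<epsilon> x r = 0" if "r \<in> {0..<T}" "R \<le> norm x" for x :: "real^'n" and r
      using moving_weight_eq_0[OF \<epsilon>] that by (simp add: R_def)
    define E where "E r = integral (cbox (-b) b) (\<lambda>x. \<theta> x r * moving_weight \<mu> \<epsilon> x r)" for r
    have E_nn: "(\<integral>\<^sup>+ x. ennreal (\<theta> x r * moving_weight \<mu> \<epsilon> x r) \<partial>lborel) = ennreal (E r)"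
      if r: "r \<in> {0..<T}" for r
    proof -
      have "((\<lambda>x. \<theta> x r * moving_weight \<mu> \<epsilon> x r) has_integral E r) (cbox (-b) b)"
        unfolding E_def
        by (intro integrable_integral integrable_continuous continuous_intros \<theta>_cont_slice r
            continuous_on_subset[OF w_cont]) auto
      from nn_integral_has_integral_lebesgue'[OF mult_nonneg_nonneg[OF nonneg moving_weight_nonneg] this]
      have "(\<integral>\<^sup>+ x. ennreal (\<theta> x r * moving_weight \<mu> \<epsilon> x r) * indicator (cbox (-b) b) x \<partial>lborel) = ennreal (E r)"
        .
      moreover have "ennreal (\<theta> x r * moving_weight \<mu> \<epsilon> x r) * indicator (cbox (-b) b) x
          = ennreal (\<theta> x r * moving_weight \<mu> \<epsilon> x r)" for x
        using supp[OF r, of x] b by (cases "R \<le> norm x") (auto simp: indicator_def subset_iff)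
      ultimately show ?thesis by simp
    qed
    define E' where "E' r = integral (cbox (-b) b) (\<lambda>x. \<theta> x r * moving_weight_deriv \<mu> \<epsilon> (x, r) (v x r, 1))" for r
    have E': "(E has_real_derivative E' r) (at r within {0..<T})" if "r \<in> {0..<T}" for r
      unfolding E_def E'_def
      by (rule weighted_integral_has_derivative[OF moving_weight_has_derivative
            continuous_on_moving_weight_deriv supp b that])
    have sign: "0 \<le> (t - s) * E' r" if r: "r \<in> {min s t..max s t}" for r
    proof -
      have "0 \<le> (t - s) * (\<theta> x r * moving_weight_deriv \<mu> \<epsilon> (x, r) (v x r, 1))" for x
      proof -
        have "(t - s) * (\<mu> * (1 + x \<bullet> x) + 2 * (v x r \<bullet> x)) \<le> 0"
          using L(2)[OF r, of x] False unfolding \<mu>_def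
          by (auto simp: mult_le_0_iff)
        then have "0 \<le> (- 2 * max 0 (1 - \<epsilon> * exp (\<mu> * r) * (1 + x \<bullet> x)) * (\<epsilon> * exp (\<mu> * r))) *
            ((t - s) * (\<mu> * (1 + x \<bullet> x) + 2 * (v x r \<bullet> x)))"
          using \<epsilon> by (intro mult_nonpos_nonpos) (auto simp: mult_nonpos_nonneg)
        then have "0 \<le> \<theta> x r * \<dots>" by (rule mult_nonneg_nonneg[OF nonneg])
        then show ?thesis unfolding moving_weight_deriv_apply by (simp add: mult_ac)
      qed
      then have "0 \<le> integral (cbox (-b) b) (\<lambda>x. (t - s) * (\<theta> x r * moving_weight_deriv \<mu> \<epsilon> (x, r) (v x r, 1)))"
        by (metis (no_types, lifting) integral_nonneg not_integrable_integral order_refl)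
      then show ?thesis by (simp add: E'_def)
    qed
    have "\<exists>r\<in>{min s t<..<max s t}. E (max s t) - E (min s t) = E' r * (max s t - min s t)"
    proof (rule mvt_simple)
      fix r assume "min s t \<le> r" "r \<le> max s t"
      then have "r \<in> {0..<T}" using sub by auto
      from has_derivative_subset[OF E'[OF this, unfolded has_field_derivative_def] sub]
      show "(E has_derivative (*) (E' r)) (at r within {min s t..max s t})"
        .
    qed (use False in auto)
    then obtain r where "min s t < r" "r < max s t"
      and r: "E (max s t) - E (min s t) = E' r * (max s t - min s t)" by auto
    then have "0 \<le> (t - s) * E' r" by (intro sign) auto
    moreover have "E t - E s = (t - s) * E' r"
      using r by (cases "s \<le> t") (simp_all add: algebra_simps)
    ultimately have "E s \<le> E t" by simp
    then have "(\<integral>\<^sup>+ x. ennreal (\<theta> x s * moving_weight \<mu> \<epsilon> x s) \<partial>lborel)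
        \<le> (\<integral>\<^sup>+ x. ennreal (\<theta> x t * moving_weight \<mu> \<epsilon> x t) \<partial>lborel)"
      using E_nn s t by (simp add: ennreal_leI)
    also have "\<dots> \<le> (\<integral>\<^sup>+ x. ennreal (\<theta> x t) \<partial>lborel)"
      using nonneg moving_weight_le_1[OF \<epsilon>] by (intro nn_integral_mono ennreal_leI mult_left_le) auto
    finally show ?thesis .
  qed
  show ?thesis
  proof (rule nn_integral_le_of_pointwise_limit[OF _ _ weighted])
    show "(\<lambda>x. ennreal (\<theta> x s * moving_weight \<mu> (inverse (real (Suc n))) x s)) \<in> borel_measurable lborel" for n
      using borel_measurable_continuous_onI[OF w_cont] \<theta>_borel[OF s] by simp
    show "(\<lambda>n. ennreal (\<theta> x s * moving_weight \<mu> (inverse (real (Suc n))) x s)) \<longlonglongrightarrow> ennreal (\<theta> x s)" for x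
    proof (rule tendsto_ennrealI)
      show "(\<lambda>n. \<theta> x s * moving_weight \<mu> (inverse (real (Suc n))) x s) \<longlonglongrightarrow> \<theta> x s"
        using tendsto_mult[OF tendsto_const[of "\<theta> x s"] moving_weight_tendsto_1[of \<mu> x s]]
        by (simp only: mult_1_right)
    qed
  qed simp
qed simp

text \<open>
  For small \<open>p\<close> the function \<open>r \<mapsto> \<bar>r\<bar> powr p\<close> is not differentiable at 0. It is the limit from below
  of \<open>(r\<^sup>2) ^ m * (r\<^sup>2 + \<epsilon>) powr (p / 2 - m)\<close>, which is continuously differentiable for \<open>\<epsilon> > 0\<close>.
\<close>

lemma nn_integral_powr_le:
  assumes p: "p > 0" and s: "s \<in> {0..<T}" and t: "t \<in> {0..<T}"
  shows "(\<integral>\<^sup>+ x. ennreal (\<bar>\<theta> x s\<bar> powr p) \<partial>lborel) \<le> (\<integral>\<^sup>+ x. ennreal (\<bar>\<theta> x t\<bar> powr p) \<partial>lborel)"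
proof -
  \<comment> \<open>With \<open>m \<ge> p / 2\<close> the exponent \<open>a\<close> is not positive, so the approximation lies below the power.\<close>
  define m where "m = Suc (nat \<lceil>p\<rceil>)"
  define a where "a = p / 2 - real m"
  have m: "m \<ge> 1" "a \<le> 0" using p unfolding m_def a_def by linarith+
  define \<phi> where "\<phi> \<epsilon> r = (r\<^sup>2) ^ m * (r\<^sup>2 + \<epsilon>) powr a" for \<epsilon> r :: real
  define \<phi>' where "\<phi>' \<epsilon> r = real m * (r\<^sup>2) ^ (m - 1) * (2 * r) * (r\<^sup>2 + \<epsilon>) powr a
      + (r\<^sup>2) ^ m * (a * (r\<^sup>2 + \<epsilon>) powr (a - 1) * (2 * r))" for \<epsilon> r :: real
  have pos: "0 < r\<^sup>2 + \<epsilon>" if "\<epsilon> > 0" for r \<epsilon> :: real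
    using that by (simp add: add_nonneg_pos)
  have deriv: "(\<phi> \<epsilon> has_real_derivative \<phi>' \<epsilon> r) (at r)" if \<epsilon>: "\<epsilon> > 0" for r \<epsilon>
  proof -
    have "((\<lambda>r. (r\<^sup>2 + \<epsilon>) powr a) has_real_derivative a * (r\<^sup>2 + \<epsilon>) powr (a - 1) * (2 * r)) (at r)"
      by (rule DERIV_chain2[where f = "\<lambda>z. z powr a" and g = "\<lambda>r. r\<^sup>2 + \<epsilon>",
            OF has_real_derivative_powr[OF pos[OF \<epsilon>]]])
         (auto intro!: derivative_eq_intros)
    moreover have "((\<lambda>r. (r\<^sup>2) ^ m) has_real_derivative real m * (r\<^sup>2) ^ (m - 1) * (2 * r)) (at r)"
      by (auto intro!: derivative_eq_intros)
    ultimately show ?thesis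
      unfolding \<phi>_def[abs_def] \<phi>'_def
      by (intro DERIV_cong[OF DERIV_mult]) (auto simp: mult.commute)
  qed
  have cont: "continuous_on UNIV (\<phi>' \<epsilon>)" if \<epsilon>: "\<epsilon> > 0" for \<epsilon>
    unfolding \<phi>'_def[abs_def] using pos[OF \<epsilon>]
    by (intro continuous_intros) (auto simp: less_imp_neq[symmetric])
  have nonneg: "0 \<le> \<phi> \<epsilon> r" for \<epsilon> r by (simp add: \<phi>_def)
  have split: "(r\<^sup>2) ^ m * (r\<^sup>2) powr a = \<bar>r\<bar> powr p" if "r \<noteq> 0" for r :: real
  proof -
    have "(r\<^sup>2) ^ m * (r\<^sup>2) powr a = (r\<^sup>2) powr (p / 2)"
      using that by (simp add: powr_realpow[symmetric] powr_add[symmetric] a_def)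
    also have "\<dots> = (\<bar>r\<bar> powr 2) powr (p / 2)" using that by (simp add: powr_numeral)
    also have "\<dots> = \<bar>r\<bar> powr p" by (simp only: powr_powr) simp
    finally show ?thesis .
  qed
  have le: "\<phi> \<epsilon> r \<le> \<bar>r\<bar> powr p" if \<epsilon>: "\<epsilon> > 0" for \<epsilon> r
  proof (cases "r = 0")
    case False
    then have "\<phi> \<epsilon> r \<le> (r\<^sup>2) ^ m * (r\<^sup>2) powr a"
      unfolding \<phi>_def using m \<epsilon> by (intro mult_left_mono powr_mono2') auto
    then show ?thesis using split False by simp
  qed (simp add: \<phi>_def m_def)
  have lim: "(\<lambda>n. \<phi> (inverse (real (Suc n))) r) \<longlonglongrightarrow> \<bar>r\<bar> powr p" for r
  proof (cases "r = 0")
    case False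
    then have "(\<lambda>n. \<phi> (inverse (real (Suc n))) r) \<longlonglongrightarrow> (r\<^sup>2) ^ m * (r\<^sup>2 + 0) powr a"
      unfolding \<phi>_def by (intro tendsto_intros LIMSEQ_inverse_real_of_nat) simp
    then show ?thesis using split False by simp
  qed (simp add: \<phi>_def m_def)
  have bound: "(\<integral>\<^sup>+ x. ennreal (\<phi> \<epsilon> (\<theta> x s)) \<partial>lborel) \<le> (\<integral>\<^sup>+ x. ennreal (\<bar>\<theta> x t\<bar> powr p) \<partial>lborel)"
    if \<epsilon>: "\<epsilon> > 0" for \<epsilon>
  proof -
    interpret \<phi>: transport T "\<lambda>x t. \<phi> \<epsilon> (\<theta> x t)" "\<lambda>z. \<phi>' \<epsilon> (\<theta> (fst z) (snd z)) *\<^sub>R D z" v G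
      by (rule transport_compose[OF deriv[OF \<epsilon>] cont[OF \<epsilon>]])
    have "(\<integral>\<^sup>+ x. ennreal (\<phi> \<epsilon> (\<theta> x s)) \<partial>lborel) \<le> (\<integral>\<^sup>+ x. ennreal (\<phi> \<epsilon> (\<theta> x t)) \<partial>lborel)"
      by (rule \<phi>.nn_integral_le[OF nonneg s t])
    also have "\<dots> \<le> (\<integral>\<^sup>+ x. ennreal (\<bar>\<theta> x t\<bar> powr p) \<partial>lborel)"
      by (intro nn_integral_mono ennreal_leI le \<epsilon>)
    finally show ?thesis .
  qed
  show ?thesis
  proof (rule nn_integral_le_of_pointwise_limit[OF _ _ bound])
    show "(\<lambda>x. ennreal (\<phi> (inverse (real (Suc n))) (\<theta> x s))) \<in> borel_measurable lborel" for n
      using \<theta>_borel[OF s] unfolding \<phi>_def by measurable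
    show "(\<lambda>n. ennreal (\<phi> (inverse (real (Suc n))) (\<theta> x s))) \<longlonglongrightarrow> ennreal (\<bar>\<theta> x s\<bar> powr p)" for x
      by (intro tendsto_ennrealI lim)
  qed simp
qed

text \<open>
  Conservation also works backwards in time, which makes a solution that vanishes at one time
  vanish at all times.
\<close>

lemma zero_of_nn_integral_powr_0:
  assumes "p > 0" and s: "s \<in> {0..<T}" and t: "t \<in> {0..<T}"
    and zero: "(\<integral>\<^sup>+ x. ennreal (\<bar>\<theta> x s\<bar> powr p) \<partial>lborel) = 0"
  shows "\<theta> x t = 0"
proof -
  have "(\<integral>\<^sup>+ x. ennreal (\<bar>\<theta> x t\<bar> powr p) \<partial>lborel) = 0"
    using nn_integral_powr_le[OF \<open>p > 0\<close> t s] zero by simp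
  then have "AE x in lborel. ennreal (\<bar>\<theta> x t\<bar> powr p) = 0"
    using \<theta>_borel[OF t] by (subst (asm) nn_integral_0_iff_AE) auto
  then have "AE x in lborel. \<theta> x t = 0"
    by (rule AE_mp) (auto intro!: AE_I2 simp: ennreal_eq_0_iff)
  moreover have op: "open {x. \<theta> x t \<noteq> 0}"
    by (intro open_Collect_neq \<theta>_cont_slice[OF t] continuous_on_const)
  ultimately have "{x. \<theta> x t \<noteq> 0} \<in> null_sets lborel"
    by (subst (asm) AE_iff_null) auto
  then have "negligible {x. \<theta> x t \<noteq> 0}"
    by (simp add: negligible_iff_null_sets null_sets_completionI)
  with op have "{x. \<theta> x t \<noteq> 0} = {}"
    using open_not_negligible by blast
  then show ?thesis by blast
qed

end

section \<open>Exponents and scaling\<close>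

lemma nn_integral_lborel_scaleR:
  fixes f :: "'a::euclidean_space \<Rightarrow> ennreal"
  assumes f: "f \<in> borel_measurable borel" and s: "s > 0"
  shows "(\<integral>\<^sup>+ x. f (x /\<^sub>R s) \<partial>lborel) = ennreal (s ^ DIM('a)) * (\<integral>\<^sup>+ x. f x \<partial>lborel)"
proof -
  have "(\<integral>\<^sup>+ x. f (x /\<^sub>R s) \<partial>lborel) =
      (\<integral>\<^sup>+ x. f (x /\<^sub>R s) \<partial>density (distr lborel borel (\<lambda>x::'a. 0 + s *\<^sub>R x)) (\<lambda>_. \<bar>s\<bar> ^ DIM('a)))"
    using lborel_affine[of s "0::'a"] s by simp
  also have "\<dots> = (\<integral>\<^sup>+ x. ennreal (s ^ DIM('a)) * f x \<partial>lborel)"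
    using f s by (subst nn_integral_density, simp, simp) (subst nn_integral_distr, auto)
  also have "\<dots> = ennreal (s ^ DIM('a)) * (\<integral>\<^sup>+ x. f x \<partial>lborel)"
    using f by (intro nn_integral_cmult) auto
  finally show ?thesis .
qed

text \<open>
  If \<open>p2\<close> is infinite, boundedness of \<open>f\<close> gives integrability of \<open>\<bar>f\<bar> powr q\<close> for every \<open>q\<close> above \<open>p1\<close>, so that
  conservation and scaling of integrals with finite exponents suffice.
\<close>

lemma Lp_finite_exponents:
  assumes p: "0 < p1" "p1 < p2" and f: "f \<in> Lp p1 \<inter> Lp p2"
  obtains q1 q2 :: real where "0 < q1" "q1 < q2"
    "(\<integral>\<^sup>+ x. ennreal (\<bar>f x\<bar> powr q1) \<partial>lborel) < \<infinity>"
    "(\<integral>\<^sup>+ x. ennreal (\<bar>f x\<bar> powr q2) \<partial>lborel) < \<infinity>"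
proof -
  define q1 where "q1 = enn2real p1"
  have p1: "p1 \<noteq> \<infinity>" using p by auto
  then have q1: "0 < q1" using p by (simp add: q1_def enn2real_positive_iff less_top)
  have i1: "(\<integral>\<^sup>+ x. ennreal (\<bar>f x\<bar> powr q1) \<partial>lborel) < \<infinity>"
    using f p1 by (auto simp: Lp_def q1_def nn_integral_completion)
  show thesis
  proof (cases "p2 = \<infinity>")
    case False
    have "q1 < enn2real p2" using p False p1 unfolding q1_def
      by (subst enn2real_less_iff) (auto simp: less_top)
    moreover have "(\<integral>\<^sup>+ x. ennreal (\<bar>f x\<bar> powr enn2real p2) \<partial>lborel) < \<infinity>"
      using f False by (auto simp: Lp_def nn_integral_completion)
    ultimately show thesis using that q1 i1 by blast
  next
    case True
    then obtain C where "AE x in lebesgue. \<bar>f x\<bar> \<le> C" and meas: "f \<in> borel_measurable lebesgue"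
      using f by (auto simp: Lp_def)
    then have "AE x in lebesgue. ennreal (\<bar>f x\<bar> powr (q1 + 1)) \<le> ennreal \<bar>C\<bar> * ennreal (\<bar>f x\<bar> powr q1)"
    proof (elim AE_mp, intro AE_I2 impI)
      fix x assume "\<bar>f x\<bar> \<le> C"
      then have "\<bar>f x\<bar> * \<bar>f x\<bar> powr q1 \<le> \<bar>C\<bar> * \<bar>f x\<bar> powr q1"
        by (intro mult_right_mono) auto
      moreover have "\<bar>f x\<bar> powr (q1 + 1) = \<bar>f x\<bar> * \<bar>f x\<bar> powr q1"
        by (simp add: powr_add mult.commute)
      ultimately show "ennreal (\<bar>f x\<bar> powr (q1 + 1)) \<le> ennreal \<bar>C\<bar> * ennreal (\<bar>f x\<bar> powr q1)"
        by (simp add: ennreal_mult[symmetric] ennreal_leI)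
    qed
    then have "(\<integral>\<^sup>+ x. ennreal (\<bar>f x\<bar> powr (q1 + 1)) \<partial>lebesgue)
        \<le> (\<integral>\<^sup>+ x. ennreal \<bar>C\<bar> * ennreal (\<bar>f x\<bar> powr q1) \<partial>lebesgue)"
      by (rule nn_integral_mono_AE)
    also have "\<dots> = ennreal \<bar>C\<bar> * (\<integral>\<^sup>+ x. ennreal (\<bar>f x\<bar> powr q1) \<partial>lebesgue)"
      using meas by (intro nn_integral_cmult) measurable
    also have "\<dots> < \<infinity>" using i1 by (simp add: nn_integral_completion ennreal_mult_less_top)
    finally show thesis using that[OF q1 _ i1, of "q1 + 1"] by (simp add: nn_integral_completion)
  qed
qed

section \<open>Self-similar solutions of the quasi-geostrophic equation\<close>

lemma qg_solution_imp_transport: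
  assumes sol: "qg_solution T \<theta>\<^sub>0 \<theta>"
  obtains D v G where "transport T \<theta> D v G"
proof -
  define v where "v x t = qg_velocity (\<lambda>y. \<theta> y t) x" for x t
  let ?S = "UNIV \<times> {0..<T} :: ((real^2) \<times> real) set"
  obtain D :: "(real^2) \<times> real \<Rightarrow> ((real^2) \<times> real) \<Rightarrow>\<^sub>L real"
    where D: "\<And>z. z \<in> ?S \<Longrightarrow> ((\<lambda>(x, t). \<theta> x t) has_derivative D z) (at z within ?S)"
      and D_cont: "continuous_on ?S D"
    using sol by (auto simp: qg_solution_def C1_on_def)
  have "C_C1 T v" using sol by (simp add: qg_solution_def v_def[abs_def])
  then obtain G where v_cont: "continuous_on ?S (\<lambda>(x, t). v x t)"
    and G_cont: "continuous_on {0..<T} G"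
    and G: "\<And>t x. t \<in> {0..<T} \<Longrightarrow>
      ((\<lambda>y. v y t) has_derivative blinfun_apply (apply_bcontfun (G t) x)) (at x)"
    unfolding C_C1_def by blast
  have "transport T \<theta> D v G"
  proof
    fix t x assume t: "t \<in> {0..<T}"
    have stream: "stream (\<lambda>y. \<theta> y t) differentiable (at y)" for y
      using sol t by (auto simp: qg_solution_def has_qg_velocity_def)
    show "(\<Sum>i\<in>UNIV. G t x (axis i 1) $ i) = 0"
      using qg_velocity_divergence_free[OF stream G[OF t, unfolded v_def]] .
    have "((\<lambda>y. (y, t)) has_derivative (\<lambda>h. (h, 0))) (at x within UNIV)"
      by (auto intro!: derivative_eq_intros)
    then have "((\<lambda>y. (\<lambda>(x, t). \<theta> x t) (y, t)) has_derivative (\<lambda>h. D (x, t) (h, 0))) (at x within UNIV)"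
      by (rule has_derivative_in_compose2[OF D, rotated 3]) (use t in auto)
    then have space: "frechet_derivative (\<lambda>y. \<theta> y t) (at x) = (\<lambda>h. D (x, t) (h, 0))"
      using frechet_derivative_at by fastforce
    have "((\<lambda>s. (x, s)) has_derivative (\<lambda>h. (0, h))) (at t within {0..<T})"
      by (auto intro!: derivative_eq_intros)
    then have "((\<lambda>s. (\<lambda>(x, t). \<theta> x t) (x, s)) has_derivative (\<lambda>h. D (x, t) (0, h))) (at t within {0..<T})"
      by (rule has_derivative_in_compose2[OF D, rotated 3]) (use t in auto)
    moreover have "(\<lambda>h. D (x, t) (0, h)) = (\<lambda>h. h *\<^sub>R D (x, t) (0, 1))"
    proof
      show "D (x, t) (0, h) = h *\<^sub>R D (x, t) (0, 1)" for h
        using blinfun.scaleR_right[of "D (x, t)" h "(0, 1)"] by simp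
    qed
    ultimately have "((\<lambda>s. \<theta> x s) has_vector_derivative D (x, t) (0, 1)) (at t within {0..<T})"
      by (simp only: has_vector_derivative_def prod.case)
    moreover have "at t within {0..<T} \<noteq> bot"
    proof -
      \<comment> \<open>The interval is one-sided at time 0, but derivatives within it are still unique.\<close>
      have "t islimpt {t<..<T}" using t by (simp add: islimpt_greaterThanLessThan1)
      then have "t islimpt {0..<T}" by (rule islimpt_subset) (use t in auto)
      then show ?thesis by (simp add: trivial_limit_within)
    qed
    ultimately have time: "vector_derivative (\<lambda>s. \<theta> x s) (at t within {0..<T}) = D (x, t) (0, 1)"
      by (intro vector_derivative_within)
    have "v x t \<bullet> grad (\<lambda>y. \<theta> y t) x = (\<Sum>i\<in>UNIV. v x t $ i * D (x, t) (axis i 1, 0))"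
      by (simp add: inner_vec_def grad_def space)
    also have "\<dots> = D (x, t) (\<Sum>i\<in>UNIV. v x t $ i *\<^sub>R (axis i 1, 0))"
      by (simp only: blinfun.sum_right blinfun.scaleR_right real_scaleR_def)
    also have "(\<Sum>i\<in>UNIV. v x t $ i *\<^sub>R (axis i 1, 0)) = (\<Sum>i\<in>UNIV. v x t $ i *\<^sub>R axis i (1::real), 0::real)"
      by (simp add: prod_eq_iff fst_sum snd_sum)
    also have "(\<Sum>i\<in>UNIV. v x t $ i *\<^sub>R axis i (1::real)) = v x t"
      by (simp add: basis_expansion scalar_mult_eq_scaleR[symmetric])
    finally have "v x t \<bullet> grad (\<lambda>y. \<theta> y t) x = D (x, t) (v x t, 0)" .
    moreover have "vector_derivative (\<lambda>s. \<theta> x s) (at t within {0..<T}) + v x t \<bullet> grad (\<lambda>y. \<theta> y t) x = 0"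
      using sol t by (simp add: qg_solution_def v_def)
    ultimately show "D (x, t) (v x t, 1) = 0"
      using time blinfun.add_right[of "D (x, t)" "(0, 1)" "(v x t, 0)"] by simp
  qed (use D D_cont v_cont G_cont G in auto)
  then show thesis by (rule that)
qed

theorem theorem2p5:
  fixes \<alpha> T :: real
  assumes "\<alpha> \<noteq> -1" and "T > 0"
  shows "\<not> (\<exists>(\<theta>\<^sub>0 :: real^2 \<Rightarrow> real) (\<theta> :: real^2 \<Rightarrow> real \<Rightarrow> real) (\<Theta> :: real^2 \<Rightarrow> real).
      qg_solution T \<theta>\<^sub>0 \<theta> \<and>
      (\<exists>x. \<exists>t\<in>{0..<T}. \<theta> x t \<noteq> 0) \<and>
      (\<forall>\<^sub>F t in at_left T. \<forall>x.
         \<theta> x t = 1 / (T - t) powr (\<alpha> / (\<alpha> + 1)) * \<Theta> (x /\<^sub>R (T - t) powr (1 / (\<alpha> + 1)))) \<and>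
      (\<exists>p\<^sub>1 p\<^sub>2 :: ennreal. 0 < p\<^sub>1 \<and> p\<^sub>1 < p\<^sub>2 \<and> \<Theta> \<in> Lp p\<^sub>1 \<inter> Lp p\<^sub>2))"
proof
  assume "\<exists>(\<theta>\<^sub>0 :: real^2 \<Rightarrow> real) (\<theta> :: real^2 \<Rightarrow> real \<Rightarrow> real) (\<Theta> :: real^2 \<Rightarrow> real).
      qg_solution T \<theta>\<^sub>0 \<theta> \<and>
      (\<exists>x. \<exists>t\<in>{0..<T}. \<theta> x t \<noteq> 0) \<and>
      (\<forall>\<^sub>F t in at_left T. \<forall>x.
         \<theta> x t = 1 / (T - t) powr (\<alpha> / (\<alpha> + 1)) * \<Theta> (x /\<^sub>R (T - t) powr (1 / (\<alpha> + 1)))) \<and>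
      (\<exists>p\<^sub>1 p\<^sub>2 :: ennreal. 0 < p\<^sub>1 \<and> p\<^sub>1 < p\<^sub>2 \<and> \<Theta> \<in> Lp p\<^sub>1 \<inter> Lp p\<^sub>2)"
  then obtain \<theta>\<^sub>0 \<theta> \<Theta> x\<^sub>0 t\<^sub>0 p\<^sub>1 p\<^sub>2 where sol: "qg_solution T \<theta>\<^sub>0 \<theta>"
    and nontrivial: "t\<^sub>0 \<in> {0..<T}" "\<theta> x\<^sub>0 t\<^sub>0 \<noteq> 0"
    and similar: "\<forall>\<^sub>F t in at_left T. \<forall>x.
         \<theta> x t = 1 / (T - t) powr (\<alpha> / (\<alpha> + 1)) * \<Theta> (x /\<^sub>R (T - t) powr (1 / (\<alpha> + 1)))"
    and p: "0 < p\<^sub>1" "p\<^sub>1 < p\<^sub>2" "\<Theta> \<in> Lp p\<^sub>1 \<inter> Lp p\<^sub>2"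
    by blast
  obtain D v G where "transport T \<theta> D v G"
    using qg_solution_imp_transport[OF sol] .
  then interpret transport T \<theta> D v G .
  define s where "s t = (T - t) powr (1 / (\<alpha> + 1))" for t
  obtain b where "b < T" and b: "\<And>t x. b < t \<Longrightarrow> t < T \<Longrightarrow>
      \<theta> x t = 1 / (T - t) powr (\<alpha> / (\<alpha> + 1)) * \<Theta> (x /\<^sub>R s t)"
    using similar unfolding eventually_at_left_field s_def by blast
  define I where "I = {max b 0<..<T}"
  have I: "t \<in> {0..<T}" "s t > 0" if "t \<in> I" for t
    using that by (auto simp: I_def s_def)
  have form: "\<theta> x t = s t powr - \<alpha> * \<Theta> (x /\<^sub>R s t)" if "t \<in> I" for x t
    using b[of t x] that by (simp add: I_def s_def powr_powr powr_minus_divide)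
  obtain t\<^sub>1 t\<^sub>2 where t12: "t\<^sub>1 \<in> I" "t\<^sub>2 \<in> I" "t\<^sub>1 < t\<^sub>2"
  proof -
    obtain t\<^sub>1 where "max b 0 < t\<^sub>1" "t\<^sub>1 < T"
      using dense[of "max b 0" T] \<open>b < T\<close> \<open>T > 0\<close> by auto
    moreover from \<open>t\<^sub>1 < T\<close> obtain t\<^sub>2 where "t\<^sub>1 < t\<^sub>2" "t\<^sub>2 < T" using dense by blast
    ultimately show thesis by (intro that[of t\<^sub>1 t\<^sub>2]) (auto simp: I_def)
  qed
  \<comment> \<open>The profile is a rescaled time slice of the solution, so it inherits continuity from it.\<close>
  have \<Theta>_borel: "\<Theta> \<in> borel_measurable borel"
  proof -
    have "\<Theta> y = s t\<^sub>1 powr \<alpha> * \<theta> (s t\<^sub>1 *\<^sub>R y) t\<^sub>1" for y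
      using form[OF t12(1), of "s t\<^sub>1 *\<^sub>R y"] I(2)[OF t12(1)]
      by (simp add: mult.assoc[symmetric] powr_add[symmetric])
    moreover have "(\<lambda>y. s t\<^sub>1 powr \<alpha> * \<theta> (s t\<^sub>1 *\<^sub>R y) t\<^sub>1) \<in> borel_measurable borel"
      using measurable_compose[OF _ \<theta>_borel[OF I(1)[OF t12(1)]], of "\<lambda>y. s t\<^sub>1 *\<^sub>R y" borel] by simp
    ultimately show ?thesis by presburger
  qed
  define N where "N p = (\<integral>\<^sup>+ y. ennreal (\<bar>\<Theta> y\<bar> powr p) \<partial>lborel)" for p
  have scaling: "(\<integral>\<^sup>+ x. ennreal (\<bar>\<theta> x t\<bar> powr p) \<partial>lborel) = ennreal (s t powr (2 - \<alpha> * p)) * N p"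
    if t: "t \<in> I" for t p
  proof -
    note st = I(2)[OF t]
    have meas [measurable]: "(\<lambda>y. ennreal (\<bar>\<Theta> y\<bar> powr p)) \<in> borel_measurable borel"
      using \<Theta>_borel by measurable
    have "\<bar>\<theta> x t\<bar> powr p = s t powr (- \<alpha> * p) * \<bar>\<Theta> (x /\<^sub>R s t)\<bar> powr p" for x
      by (simp add: form[OF t] abs_mult powr_mult powr_powr)
    then have "(\<integral>\<^sup>+ x. ennreal (\<bar>\<theta> x t\<bar> powr p) \<partial>lborel) =
        (\<integral>\<^sup>+ x. ennreal (s t powr (- \<alpha> * p)) * ennreal (\<bar>\<Theta> (x /\<^sub>R s t)\<bar> powr p) \<partial>lborel)"
      by (simp add: ennreal_mult)
    also have "\<dots> = ennreal (s t powr (- \<alpha> * p)) * (\<integral>\<^sup>+ x. ennreal (\<bar>\<Theta> (x /\<^sub>R s t)\<bar> powr p) \<partial>lborel)"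
      by (intro nn_integral_cmult measurable_compose[where f = "\<lambda>x. x /\<^sub>R s t"
            and g = "\<lambda>y. ennreal (\<bar>\<Theta> y\<bar> powr p)" and N = borel]) measurable
    also have "(\<integral>\<^sup>+ x. ennreal (\<bar>\<Theta> (x /\<^sub>R s t)\<bar> powr p) \<partial>lborel) = ennreal (s t ^ 2) * N p"
      using nn_integral_lborel_scaleR[OF meas st]
      by (simp add: N_def)
    also have "ennreal (s t powr (- \<alpha> * p)) * (ennreal (s t ^ 2) * N p) =
        ennreal (s t powr (- \<alpha> * p) * s t ^ 2) * N p"
      by (simp add: ennreal_mult mult.assoc)
    also have "s t powr (- \<alpha> * p) * s t ^ 2 = s t powr (2 - \<alpha> * p)"
      using st by (simp add: powr_diff powr_minus divide_inverse mult.commute)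
    finally show ?thesis .
  qed
  \<comment> \<open>Conservation between two distinct times is compatible with scaling only at the critical exponent.\<close>
  have critical: "\<alpha> * p = 2" if p: "p > 0" "N p < \<infinity>" for p
  proof -
    \<comment> \<open>Otherwise the solution would vanish at time \<open>t\<^sub>1\<close>, hence always.\<close>
    have "N p \<noteq> 0"
      using zero_of_nn_integral_powr_0[OF p(1) I(1)[OF t12(1)] nontrivial(1)] scaling[OF t12(1), of p]
        nontrivial(2) by auto
    with p(2) obtain r where r: "N p = ennreal r" "r > 0"
      by (cases "N p") (auto simp: less_le)
    have "ennreal (s t\<^sub>1 powr (2 - \<alpha> * p)) * N p = ennreal (s t\<^sub>2 powr (2 - \<alpha> * p)) * N p"
      using nn_integral_powr_le[OF p(1) I(1)[OF t12(1)] I(1)[OF t12(2)]]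
        nn_integral_powr_le[OF p(1) I(1)[OF t12(2)] I(1)[OF t12(1)]]
        scaling[OF t12(1)] scaling[OF t12(2)] by (metis order_antisym)
    then have "s t\<^sub>1 powr (2 - \<alpha> * p) = s t\<^sub>2 powr (2 - \<alpha> * p)"
      using r by (simp add: ennreal_mult[symmetric])
    then have "(T - t\<^sub>1) powr ((2 - \<alpha> * p) / (\<alpha> + 1)) = (T - t\<^sub>2) powr ((2 - \<alpha> * p) / (\<alpha> + 1))"
      by (simp add: s_def powr_powr)
    then have "ln ((T - t\<^sub>1) powr ((2 - \<alpha> * p) / (\<alpha> + 1))) = ln ((T - t\<^sub>2) powr ((2 - \<alpha> * p) / (\<alpha> + 1)))"
      by simp
    moreover have "ln (T - t\<^sub>1) \<noteq> ln (T - t\<^sub>2)"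
      using t12 by (simp add: I_def)
    ultimately have "(2 - \<alpha> * p) / (\<alpha> + 1) = 0"
      using t12 by (auto simp: I_def ln_powr)
    moreover have "\<alpha> + 1 \<noteq> 0" using \<open>\<alpha> \<noteq> -1\<close> by linarith
    ultimately show ?thesis by simp
  qed
  obtain q\<^sub>1 q\<^sub>2 :: real where "0 < q\<^sub>1" "q\<^sub>1 < q\<^sub>2" "N q\<^sub>1 < \<infinity>" "N q\<^sub>2 < \<infinity>"
    using Lp_finite_exponents[OF p] unfolding N_def by blast
  then have "\<alpha> * q\<^sub>1 = 2" "\<alpha> * q\<^sub>2 = 2" using critical by auto
  then have "\<alpha> * q\<^sub>1 = \<alpha> * q\<^sub>2" "\<alpha> \<noteq> 0" by auto
  with \<open>q\<^sub>1 < q\<^sub>2\<close> show False by simp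
qed

end
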